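(* The two-choice greedy algorithm whose randomized rounds use a $0.1099$-OCS is at least $0.508$-competitive for unweighted online bipartite matching.
   Context: Unweighted online bipartite matching: a finite bipartite graph with offline vertices $L$ (known in advance) and online vertices $R$ arriving one at a time (graph and order fixed in advance by an oblivious adversary). When $j\in R$ arrives, its set of neighbors $N(j)\subseteq L$ is revealed, and the algorithm immediately and irrevocably matches $j$ to some neighbor or leaves it unmatched. An offline vertex may be chosen several times, but counts once: the objective is the number of offline vertices matched at least once. A randomized algorithm is $\Gamma$-competitive if on every instance its expected objective is at least $\Gamma$ times the maximum matching size. OCS. The input is a sequence of pairs of distinct ground elements, fixed in advance and revealed one pair at a time; a randomized online selection algorithm irrevocably selects one element of each pair when it is revealed. A subsequence of pairs all containing $i$ is consecutive (with respect to $i$) if it includes all pairs containing $i$ between its first and last pair; subsequences are disjoint if they share no pair (position). For $\gamma\in[0,1]$, a $\gamma$-OCS is such an algorithm for which, for every input sequence, every element $i$ and any disjoint subsequences of $k_1,\dots,k_m\ge 1$ consecutive pairs containing $i$, the element $i$ is selected in at least one of these pairs with probability at least $1-\prod_{\ell=1}^m 2^{-k_\ell}(1-\gamma)^{k_\ell-1}$. Two-choice greedy with an OCS (ground elements are the offline vertices): for each offline vertex $i$ let $k_i$ be the number of randomized rounds so far in which $i$ was one of the two candidates, and $k_i=\infty$ if $i$ has been matched in a deterministic round. When $j$ arrives, consider the neighbors $i\in N(j)$ with $k_i<\infty$. If there are none, leave $j$ unmatched. Otherwise consider those among them with minimum $k_i$. If there are at least two such vertices, choose any two of them (by a fixed deterministic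 rule), pass this pair to the OCS, and match $j$ to the vertex selected by the OCS (randomized round). If there is exactly one, match $j$ to it (deterministic round). *)

theory Defs
  imports "HOL-Probability.Probability"
begin

text \<open>
  A randomized online algorithm is a random seed, drawn from a probability space, together with a
  deterministic online algorithm for every seed. A deterministic online algorithm maps the
  nonempty part of the input revealed so far (whose last entry is the current item) to its current
  decision; its own earlier decisions are functions of the seed and of shorter prefixes.
\<close>

section \<open>Unweighted online bipartite matching\<close>

text \<open>
  An instance consists of the offline vertices \<open>L\<close> and the list \<open>Ns\<close> of the neighborhoods of the
  online vertices in order of arrival; the online vertices themselves are the positions in \<open>Ns\<close>.
\<close>

definition matching_instance :: "'a set \<Rightarrow> 'a set list \<Rightarrow> bool" where
  "matching_instance L Ns \<longleftrightarrow> finite L \<and> (\<forall>N\<in>set Ns. N \<subseteq> L)"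

definition edges :: "'a set list \<Rightarrow> ('a \<times> nat) set" where
  "edges Ns = {(i, j). j < length Ns \<and> i \<in> Ns ! j}"

definition is_matching :: "'a set list \<Rightarrow> ('a \<times> nat) set \<Rightarrow> bool" where
  "is_matching Ns E \<longleftrightarrow> E \<subseteq> edges Ns \<and> inj_on fst E \<and> inj_on snd E"

definition max_matching_size :: "'a set list \<Rightarrow> nat" where
  "max_matching_size Ns = Max (card ` {E. is_matching Ns E})"

definition randomized_matching_algorithm ::
  "('a set \<Rightarrow> 'w measure) \<Rightarrow> ('a set \<Rightarrow> 'w \<Rightarrow> 'a set list \<Rightarrow> 'a option) \<Rightarrow> bool" where
  "randomized_matching_algorithm M A \<longleftrightarrow>
     (\<forall>L. finite L \<longrightarrow> prob_space (M L)) \<and>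
     (\<forall>L h. matching_instance L h \<and> h \<noteq> [] \<longrightarrow>
        (\<lambda>w. A L w h) \<in> measurable (M L) (count_space UNIV) \<and>
        (\<forall>w\<in>space (M L). \<forall>i. A L w h = Some i \<longrightarrow> i \<in> last h))"

definition matched :: "('a set list \<Rightarrow> 'a option) \<Rightarrow> 'a set list \<Rightarrow> 'a set" where
  "matched alg Ns = {i. \<exists>j<length Ns. alg (take (Suc j) Ns) = Some i}"

definition competitive ::
  "real \<Rightarrow> ('a set \<Rightarrow> 'w measure) \<Rightarrow> ('a set \<Rightarrow> 'w \<Rightarrow> 'a set list \<Rightarrow> 'a option) \<Rightarrow> bool" where
  "competitive \<Gamma> M A \<longleftrightarrow> randomized_matching_algorithm M A \<and>
     (\<forall>L Ns. matching_instance L Ns \<longrightarrow>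
        \<Gamma> * real (max_matching_size Ns)
          \<le> prob_space.expectation (M L) (\<lambda>w. real (card (matched (A L w) Ns))))"

section \<open>Online correlated selection\<close>

definition pair_sequence :: "'a set \<Rightarrow> 'a set list \<Rightarrow> bool" where
  "pair_sequence V ps \<longleftrightarrow> (\<forall>P\<in>set ps. P \<subseteq> V \<and> card P = 2)"

definition randomized_selection_algorithm ::
  "'a set \<Rightarrow> 'w measure \<Rightarrow> ('w \<Rightarrow> 'a set list \<Rightarrow> 'a) \<Rightarrow> bool" where
  "randomized_selection_algorithm V M sel \<longleftrightarrow> prob_space M \<and>
     (\<forall>ps. pair_sequence V ps \<and> ps \<noteq> [] \<longrightarrow>
        (\<lambda>w. sel w ps) \<in> measurable M (count_space UNIV) \<and>
        (\<forall>w\<in>space M. sel w ps \<in> last ps))"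

text \<open>
  Subsequences are represented by their sets of positions. As nonempty disjoint subsequences are
  distinct, a disjoint family of them is a set of position sets.
\<close>

definition consecutive :: "'a set list \<Rightarrow> 'a \<Rightarrow> nat set \<Rightarrow> bool" where
  "consecutive ps i T \<longleftrightarrow> T \<noteq> {} \<and> T \<subseteq> {t. t < length ps \<and> i \<in> ps ! t} \<and>
     (\<forall>t\<in>{Min T..Max T}. i \<in> ps ! t \<longrightarrow> t \<in> T)"

definition ocs ::
  "'a set \<Rightarrow> real \<Rightarrow> 'w measure \<Rightarrow> ('w \<Rightarrow> 'a set list \<Rightarrow> 'a) \<Rightarrow> bool" where
  "ocs V \<gamma> M sel \<longleftrightarrow> \<gamma> \<in> {0..1} \<and> randomized_selection_algorithm V M sel \<and>
     (\<forall>ps i \<T>. pair_sequence V ps \<and> i \<in> V \<and> (\<forall>T\<in>\<T>. consecutive ps i T) \<and> disjoint \<T> \<longrightarrow>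
        measure M {w \<in> space M. \<exists>t\<in>\<Union>\<T>. sel w (take (Suc t) ps) = i}
          \<ge> 1 - (\<Prod>T\<in>\<T>. (1 / 2) ^ card T * (1 - \<gamma>) ^ (card T - 1)))"

section \<open>Two-choice greedy\<close>

datatype 'a round = Unmatched | Deterministic 'a | Randomized "'a set"

text \<open>
  The rounds do not depend on the selections of the OCS, and hence neither does the sequence of
  pairs passed to it.
\<close>

definition level :: "'a round list \<Rightarrow> 'a \<Rightarrow> enat" where
  "level rs i = (if Deterministic i \<in> set rs then \<infinity>
     else enat (card {t. t < length rs \<and> (\<exists>P. rs ! t = Randomized P \<and> i \<in> P)}))"

definition candidates :: "'a round list \<Rightarrow> 'a set \<Rightarrow> 'a set" where
  "candidates rs N = {i. is_arg_min (level rs) (\<lambda>i. i \<in> N \<and> level rs i < \<infinity>) i}"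

text \<open>
  The rule choosing two of the candidates may use all the deterministic information available:
  the offline vertices, the neighborhoods revealed so far, and the candidates.
\<close>

definition choice_rule :: "('a set \<Rightarrow> 'a set list \<Rightarrow> 'a set \<Rightarrow> 'a set) \<Rightarrow> bool" where
  "choice_rule pick \<longleftrightarrow>
     (\<forall>L h C. finite C \<and> card C \<ge> 2 \<longrightarrow> pick L h C \<subseteq> C \<and> card (pick L h C) = 2)"

definition next_round ::
  "('a set \<Rightarrow> 'a set list \<Rightarrow> 'a set \<Rightarrow> 'a set) \<Rightarrow> 'a set \<Rightarrow> 'a set list \<Rightarrow> 'a round list \<Rightarrow> 'a round"
where
  "next_round pick L h rs =
     (let C = candidates rs (last h) in
      if C = {} then Unmatched
      else if is_singleton C then Deterministic (the_elem C)
      else Randomized (pick L h C))"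

primrec rounds ::
  "('a set \<Rightarrow> 'a set list \<Rightarrow> 'a set \<Rightarrow> 'a set) \<Rightarrow> 'a set \<Rightarrow> 'a set list \<Rightarrow> nat \<Rightarrow> 'a round list"
where
  "rounds pick L Ns 0 = []"
| "rounds pick L Ns (Suc n) =
     (let rs = rounds pick L Ns n in rs @ [next_round pick L (take (Suc n) Ns) rs])"

definition ocs_pairs :: "'a round list \<Rightarrow> 'a set list" where
  "ocs_pairs rs = [P. Randomized P \<leftarrow> rs]"

definition two_choice_greedy ::
  "('a set \<Rightarrow> 'a set list \<Rightarrow> 'a set \<Rightarrow> 'a set) \<Rightarrow> ('a set list \<Rightarrow> 'a) \<Rightarrow>
   'a set \<Rightarrow> 'a set list \<Rightarrow> 'a option"
where
  "two_choice_greedy pick sel L h =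
     (let rs = rounds pick L h (length h) in
      case last rs of
        Unmatched \<Rightarrow> None
      | Deterministic i \<Rightarrow> Some i
      | Randomized P \<Rightarrow> Some (sel (ocs_pairs rs)))"

end

theory Submission
  imports Defs
begin

text \<open>
  The proof is an online primal-dual argument. An offline vertex of level \<open>k\<close> stays unmatched with
  probability at most \<open>y k = 2\<^sup>-\<^sup>k (1 - \<gamma>)\<^bsup>k-1\<^esup>\<close> (and \<open>y \<infinity> = 0\<close>), as the pairs containing it are
  consecutive, so the expected objective is at least the sum of \<open>1 - y k\<^sub>i\<close>. Each offline vertex
  receives the dual value \<open>\<Gamma> - 2 b k\<^sub>i\<close>, and each online vertex receives what its round adds to
  the sum of \<open>1 - y k\<^sub>i - (\<Gamma> - 2 b k\<^sub>i)\<close> over the offline vertices. The duals cover every edge up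
  to \<open>\<Gamma>\<close> as soon as \<open>y k - y (k + 1) = 3 b k - 2 b (k + 1)\<close> (randomized rounds) and
  \<open>y k - 2 b k \<ge> 2 b (k + 1)\<close> (deterministic rounds), with \<open>b\<close> nonnegative and decreasing. The
  bounded solution of the recurrence with \<open>2 b 0 = \<Gamma>\<close> gives
  \<open>\<Gamma> = (3 + 2 \<gamma>) / (3 (2 + \<gamma>))\<close>.
\<close>

section \<open>The dual solution\<close>

text \<open>The homogeneous solutions of the recurrence grow like \<open>(3/2)^k\<close>, so a
  bounded solution must start at \<open>b 0 = (1/3) * sum_t (2/3)^t (y t - y (t + 1))\<close>. The
  series is geometric from \<open>t = 1\<close> on, and the ratio is twice its value.\<close>

definition greedy_ratio :: "real \<Rightarrow> real" where
  "greedy_ratio \<gamma> = (3 + 2 * \<gamma>) / (3 * (2 + \<gamma>))"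

text \<open>Truncated subtraction in the exponent gives the value 1 at level 0, as it should be for
  a vertex that was never a candidate.\<close>

definition failure_bound :: "real \<Rightarrow> enat \<Rightarrow> real" where
  "failure_bound \<gamma> k = (case k of enat n \<Rightarrow> (1 / 2) ^ n * (1 - \<gamma>) ^ (n - 1) | \<infinity> \<Rightarrow> 0)"

text \<open>The bounded solution \<open>b\<close> of the recurrence above, for \<open>y = failure_bound \<gamma>\<close>.\<close>

definition half_deficit :: "real \<Rightarrow> enat \<Rightarrow> real" where
  "half_deficit \<gamma> k = (case k of
     enat n \<Rightarrow> (case n of 0 \<Rightarrow> greedy_ratio \<gamma> / 2
                | Suc m \<Rightarrow> (1 + \<gamma>) / (4 * (2 + \<gamma>)) * ((1 - \<gamma>) / 2) ^ m)
   | \<infinity> \<Rightarrow> 0)"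

lemma failure_bound_simps [simp]:
  "failure_bound \<gamma> 0 = 1" "failure_bound \<gamma> \<infinity> = 0"
  by (simp_all add: failure_bound_def zero_enat_def)

lemma half_deficit_simps [simp]:
  "half_deficit \<gamma> 0 = greedy_ratio \<gamma> / 2" "half_deficit \<gamma> \<infinity> = 0"
  by (simp_all add: half_deficit_def zero_enat_def)

lemma half_deficit_nonneg:
  assumes "\<gamma> \<in> {0..1}"
  shows "half_deficit \<gamma> k \<ge> 0"
  using assms by (auto simp: half_deficit_def greedy_ratio_def split: enat.split nat.split)

lemma half_deficit_Suc_le:
  assumes "\<gamma> \<in> {0..1}"
  shows "half_deficit \<gamma> (enat (Suc n)) \<le> half_deficit \<gamma> (enat n)"
proof (cases n)
  case 0
  \<comment> \<open>Level 0 lies outside the geometric family; here the claim amounts to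
    \<open>3 (1 + \<gamma>) \<le> 2 (3 + 2 \<gamma>)\<close>.\<close>
  then show ?thesis
    using assms by (simp add: half_deficit_def greedy_ratio_def field_simps)
next
  case (Suc m)
  have "((1 - \<gamma>) / 2) ^ Suc m \<le> ((1 - \<gamma>) / 2) ^ m"
    using assms by (intro power_decreasing) auto
  then have "(1 + \<gamma>) / (4 * (2 + \<gamma>)) * ((1 - \<gamma>) / 2) ^ Suc m
      \<le> (1 + \<gamma>) / (4 * (2 + \<gamma>)) * ((1 - \<gamma>) / 2) ^ m"
    using assms by (intro mult_left_mono) auto
  then show ?thesis
    by (simp add: Suc half_deficit_def)
qed

lemma half_deficit_antimono:
  assumes "\<gamma> \<in> {0..1}" "k \<le> l"
  shows "half_deficit \<gamma> l \<le> half_deficit \<gamma> k"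
proof (cases l)
  case (enat n)
  then obtain m where m: "k = enat m" "m \<le> n"
    using assms(2) by (cases k) auto
  have "half_deficit \<gamma> (enat n) \<le> half_deficit \<gamma> (enat m)"
    using m(2) half_deficit_Suc_le[OF assms(1)] by (rule lift_Suc_antimono_le[rotated])
  then show ?thesis
    using enat m by simp
next
  case infinity
  then show ?thesis
    using half_deficit_nonneg[OF assms(1)] by simp
qed

text \<open>Consequently a vertex moving from level \<open>n\<close> to \<open>n + 1\<close> raises
  the surplus by \<open>half_deficit\<close> at \<open>n\<close>. For positive \<open>n\<close> both
  sides are multiples of \<open>q\<close>, and the identity reduces to
  \<open>3 - (1 - \<gamma>) = 2 + \<gamma>\<close>.\<close>

lemma failure_bound_diff:
  assumes "\<gamma> \<in> {0..1}"
  shows "failure_bound \<gamma> (enat n) - failure_bound \<gamma> (enat (Suc n))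
    = 3 * half_deficit \<gamma> (enat n) - 2 * half_deficit \<gamma> (enat (Suc n))"
proof (cases n)
  case 0
  have "2 + \<gamma> > 0"
    using assms by simp
  then show ?thesis
    unfolding 0 failure_bound_def half_deficit_def greedy_ratio_def
    by (simp add: divide_simps) (simp add: algebra_simps)
next
  case (Suc m)
  define q where "q = ((1 - \<gamma>) / 2) ^ m"
  have "(1 / 2) ^ m * (1 - \<gamma>) ^ m = q"
    by (simp add: q_def power_divide)
  then have y: "failure_bound \<gamma> (enat n) = q / 2"
      "failure_bound \<gamma> (enat (Suc n)) = q * ((1 - \<gamma>) / 4)"
    using Suc by (auto simp: failure_bound_def)
  have b: "half_deficit \<gamma> (enat n) = (1 + \<gamma>) / (4 * (2 + \<gamma>)) * q"
      "half_deficit \<gamma> (enat (Suc n)) = (1 + \<gamma>) / (4 * (2 + \<gamma>)) * (q * ((1 - \<gamma>) / 2))"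
    using Suc by (simp_all add: half_deficit_def q_def)
  have "2 + \<gamma> \<noteq> 0"
    using assms by auto
  then show ?thesis
    unfolding y b by (simp add: divide_simps) algebra
qed

lemma half_deficit_le_failure_bound:
  assumes "\<gamma> \<in> {0..1}"
  shows "2 * half_deficit \<gamma> (enat n) + 2 * half_deficit \<gamma> (enat (Suc n)) \<le> failure_bound \<gamma> (enat n)"
proof (cases n)
  case 0
  have "failure_bound \<gamma> (enat n) - 2 * half_deficit \<gamma> (enat n) - 2 * half_deficit \<gamma> (enat (Suc n))
      = (3 - \<gamma>) / (6 * (2 + \<gamma>))"
    using assms unfolding 0 failure_bound_def half_deficit_def greedy_ratio_def
    by (simp add: divide_simps) (simp add: algebra_simps)
  moreover have "\<dots> \<ge> 0"
    using assms by simp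
  ultimately show ?thesis
    by linarith
next
  case (Suc m)
  define q where "q = ((1 - \<gamma>) / 2) ^ m"
  define c where "c = (1 + \<gamma>) / (4 * (2 + \<gamma>))"
  have q: "q \<ge> 0"
    using assms by (simp add: q_def)
  \<comment> \<open>\<open>c\<close> increases with \<open>\<gamma>\<close> and reaches 1/6 at
    \<open>\<gamma> = 1\<close>; the other factor below is largest, 3/2, at
    \<open>\<gamma> = 0\<close>. Bounding each at its own extreme still yields the 1/4 that
    suffices.\<close>
  have c: "c \<ge> 0" "c \<le> 1 / 6"
    using assms by (simp_all add: c_def field_simps)
  have "c * (1 + (1 - \<gamma>) / 2) \<le> 1 / 6 * (3 / 2)"
    using c assms by (intro mult_mono) auto
  then have le: "q * (2 * c * (1 + (1 - \<gamma>) / 2)) \<le> q * (1 / 2)"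
    using q by (intro mult_left_mono) auto
  have y: "failure_bound \<gamma> (enat n) = q / 2"
    using Suc by (simp add: failure_bound_def q_def power_divide)
  have b: "half_deficit \<gamma> (enat n) = c * q"
      "half_deficit \<gamma> (enat (Suc n)) = c * (q * ((1 - \<gamma>) / 2))"
    using Suc by (simp_all add: half_deficit_def q_def c_def)
  show ?thesis
    using le unfolding y b by (simp add: field_simps)
qed

section \<open>The rounds of two-choice greedy\<close>

lemma length_rounds [simp]: "length (rounds pick L Ns n) = n"
  by (induction n) (simp_all add: Let_def)

lemma take_rounds:
  assumes "m \<le> n"
  shows "take m (rounds pick L Ns n) = rounds pick L Ns m"
  using assms by (induction n rule: dec_induct) (simp_all add: Let_def)

lemma rounds_take:
  assumes "n \<le> m"
  shows "rounds pick L (take m Ns) n = rounds pick L Ns n"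
  using assms by (induction n) (simp_all add: Let_def min_def)

lemma rounds_nth:
  assumes "t < n"
  shows "rounds pick L Ns n ! t = next_round pick L (take (Suc t) Ns) (rounds pick L Ns t)"
proof -
  have "rounds pick L Ns n ! t = take (Suc t) (rounds pick L Ns n) ! t"
    by simp
  also have "\<dots> = next_round pick L (take (Suc t) Ns) (rounds pick L Ns t)"
    using assms by (simp only: take_rounds Suc_leI) (simp add: Let_def nth_append)
  finally show ?thesis .
qed

section \<open>Levels and candidate sets\<close>

lemma level_Nil [simp]: "level [] i = 0"
  by (simp add: level_def zero_enat_def)

lemma level_eq_length_filter:
  assumes "Deterministic i \<notin> set rs"
  shows "level rs i = enat (length (filter (\<lambda>r. \<exists>P. r = Randomized P \<and> i \<in> P) rs))"
  using assms by (simp add: level_def length_filter_conv_card)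

lemma level_snoc:
  "level (rs @ [r]) i =
     (if r = Deterministic i then \<infinity>
      else if \<exists>P. r = Randomized P \<and> i \<in> P then eSuc (level rs i) else level rs i)"
proof (cases "Deterministic i \<in> set (rs @ [r])")
  case True
  then show ?thesis by (auto simp: level_def)
next
  case False
  then show ?thesis by (auto simp: level_eq_length_filter eSuc_enat)
qed

lemma candidates_subset: "candidates rs N \<subseteq> N"
  by (auto simp: candidates_def is_arg_min_def)

text \<open>The last fact says that ties at the minimum are candidates: if a round has a single
  candidate, all other neighbors have strictly larger level.\<close>

lemma candidates_level:
  assumes "i \<in> candidates rs N" "i' \<in> N"
  shows "level rs i < \<infinity>" "level rs i \<le> level rs i'"
    and "level rs i' = level rs i \<Longrightarrow> i' \<in> candidates rs N"
proof -
  have i: "level rs i < \<infinity>" "\<And>u. u \<in> N \<Longrightarrow> level rs u < \<infinity> \<Longrightarrow> level rs i \<le> level rs u"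
    using assms(1) by (auto simp: candidates_def is_arg_min_linorder)
  then show "level rs i < \<infinity>" "level rs i \<le> level rs i'"
    using assms(2) by (simp, cases "level rs i' < \<infinity>") auto
  show "i' \<in> candidates rs N" if "level rs i' = level rs i"
    using i assms(2) that by (simp add: candidates_def is_arg_min_linorder)
qed

lemma candidates_empty:
  assumes "candidates rs N = {}" "i \<in> N"
  shows "level rs i = \<infinity>"
proof (rule ccontr)
  assume "level rs i \<noteq> \<infinity>"
  let ?K = "level rs ` {i \<in> N. level rs i < \<infinity>}"
  have "level rs i \<in> ?K"
    using assms(2) \<open>level rs i \<noteq> \<infinity>\<close> by auto
  \<comment> \<open>\<open>enat\<close> is well-ordered, so one vertex of finite level already
    yields a minimizer.\<close>
  then have "(LEAST k. k \<in> ?K) \<in> ?K"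
    by (rule LeastI)
  then obtain u where u: "u \<in> N" "level rs u < \<infinity>" "(LEAST k. k \<in> ?K) = level rs u"
    by auto
  have "level rs u \<le> level rs i'" if "i' \<in> N" "level rs i' < \<infinity>" for i'
    unfolding u(3)[symmetric] using that by (intro Least_le) auto
  then have "u \<in> candidates rs N"
    using u by (simp add: candidates_def is_arg_min_linorder)
  then show False
    using assms(1) by simp
qed

lemma next_round_cases:
  assumes "choice_rule pick" "finite (last h)"
  obtains
    (Unmatched) "candidates rs (last h) = {}" "next_round pick L h rs = Unmatched"
  | (Deterministic) i where "candidates rs (last h) = {i}" "next_round pick L h rs = Deterministic i"
  | (Randomized) P where "P \<subseteq> candidates rs (last h)" "card P = 2"
      "next_round pick L h rs = Randomized P"
proof -
  let ?C = "candidates rs (last h)"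
  have fin: "finite ?C"
    using assms(2) candidates_subset by (rule finite_subset[rotated])
  consider "?C = {}" | i where "?C = {i}" | "?C \<noteq> {}" "\<not> is_singleton ?C"
    by (auto simp: is_singleton_def)
  then show thesis
  proof cases
    case 1
    then show thesis by (intro Unmatched) (auto simp: next_round_def)
  next
    case (2 i)
    then show thesis by (intro Deterministic[of i]) (auto simp: next_round_def)
  next
    case 3
    then have "card ?C \<noteq> 0" "card ?C \<noteq> 1"
      using fin by (auto simp: is_singleton_altdef)
    then have "card ?C \<ge> 2"
      by linarith
    then show thesis
      using assms(1) fin 3
      by (intro Randomized[of "pick L h ?C"]) (auto simp: next_round_def choice_rule_def)
  qed
qed

lemma last_take_Suc:
  assumes "j < length xs"
  shows "last (take (Suc j) xs) = xs ! j"
  using assms by (simp add: take_Suc_conv_app_nth)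

lemma matching_instance_nth:
  assumes "matching_instance L Ns" "j < length Ns"
  shows "Ns ! j \<subseteq> L" "finite (Ns ! j)"
proof -
  show "Ns ! j \<subseteq> L"
    using assms by (simp add: matching_instance_def)
  then show "finite (Ns ! j)"
    using assms(1) by (auto simp: matching_instance_def intro: finite_subset)
qed

lemma rounds_nth_Deterministic:
  assumes "choice_rule pick" "matching_instance L Ns" "n \<le> length Ns" "t < n"
    and "rounds pick L Ns n ! t = Deterministic i"
  shows "i \<in> Ns ! t"
proof -
  have *: "last (take (Suc t) Ns) = Ns ! t"
    using assms by (intro last_take_Suc) auto
  have "finite (last (take (Suc t) Ns))"
    using assms by (simp add: * matching_instance_nth(2))
  note cases = next_round_cases[OF assms(1) this, where rs = "rounds pick L Ns t" and L = L]
  show ?thesis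
    using assms(4,5) candidates_subset[of "rounds pick L Ns t" "Ns ! t"]
    by (cases rule: cases)
       (auto simp: rounds_nth *)
qed

lemma rounds_nth_Randomized:
  assumes "choice_rule pick" "matching_instance L Ns" "n \<le> length Ns" "t < n"
    and "rounds pick L Ns n ! t = Randomized P"
  shows "P \<subseteq> Ns ! t" "card P = 2"
proof -
  have *: "last (take (Suc t) Ns) = Ns ! t"
    using assms by (intro last_take_Suc) auto
  have "finite (last (take (Suc t) Ns))"
    using assms by (simp add: * matching_instance_nth(2))
  note cases = next_round_cases[OF assms(1) this, where rs = "rounds pick L Ns t" and L = L]
  have "P \<subseteq> Ns ! t \<and> card P = 2"
    using assms(4,5) candidates_subset[of "rounds pick L Ns t" "Ns ! t"]
    by (cases rule: cases)
       (auto simp: rounds_nth *)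
  then show "P \<subseteq> Ns ! t" "card P = 2"
    by auto
qed

section \<open>The primal-dual analysis\<close>

lemma sum_diff_eq_sum_changed:
  fixes f g :: "'a \<Rightarrow> real"
  assumes "finite L" "S \<subseteq> L" "\<And>i. i \<in> L - S \<Longrightarrow> f i = g i"
  shows "sum f L - sum g L = (\<Sum>i\<in>S. f i - g i)"
  using assms
  by (simp add: sum_subtractf[symmetric]) (intro sum.mono_neutral_right, auto)

text \<open>The guaranteed objective minus the offline duals. It vanishes at the start, when all
  levels are 0, and its increment in a round is the dual value of the arriving vertex.\<close>

definition surplus :: "real \<Rightarrow> 'a set \<Rightarrow> 'a round list \<Rightarrow> real" where
  "surplus \<gamma> L rs =
     (\<Sum>i\<in>L. 1 - failure_bound \<gamma> (level rs i) - (greedy_ratio \<gamma> - 2 * half_deficit \<gamma> (level rs i)))"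

text \<open>The online dual is nonnegative, and together with the offline dual after the round it
  covers every edge at the arriving vertex.\<close>

lemma surplus_Suc:
  assumes \<gamma>: "\<gamma> \<in> {0..1}" and "choice_rule pick" and inst: "matching_instance L Ns"
    and n: "n < length Ns"
  defines "rs \<equiv> rounds pick L Ns n" and "rs' \<equiv> rounds pick L Ns (Suc n)"
  shows "surplus \<gamma> L rs \<le> surplus \<gamma> L rs'"
    and "\<And>i. i \<in> Ns ! n \<Longrightarrow> 2 * half_deficit \<gamma> (level rs' i) \<le> surplus \<gamma> L rs' - surplus \<gamma> L rs"
proof -
  let ?h = "take (Suc n) Ns"
  let ?f = "\<lambda>rs i. 1 - failure_bound \<gamma> (level rs i) -
    (greedy_ratio \<gamma> - 2 * half_deficit \<gamma> (level rs i))"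
  have h: "last ?h = Ns ! n"
    by (rule last_take_Suc[OF n])
  have fin: "finite L" "finite (last ?h)"
    using inst matching_instance_nth(2)[OF inst n] by (auto simp: h matching_instance_def)
  have rs': "rs' = rs @ [next_round pick L ?h rs]"
    by (simp add: rs_def rs'_def Let_def)
  have CL: "candidates rs (last ?h) \<subseteq> L"
    using candidates_subset[of rs "last ?h"] matching_instance_nth(1)[OF inst n] by (auto simp: h)
  from assms(2) fin(2) have "surplus \<gamma> L rs \<le> surplus \<gamma> L rs' \<and>
    (\<forall>i\<in>Ns ! n. 2 * half_deficit \<gamma> (level rs' i) \<le> surplus \<gamma> L rs' - surplus \<gamma> L rs)"
  proof (cases rule: next_round_cases[where rs = rs and L = L])
    case Unmatched
    then have "level rs' = level rs"
      by (auto simp: rs' level_snoc)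
    \<comment> \<open>All neighbors are already matched deterministically, so their deficit is 0 and
      a zero online dual covers their edges.\<close>
    moreover have "level rs i = \<infinity>" if "i \<in> Ns ! n" for i
      using candidates_empty[OF Unmatched(1)] that by (simp add: h)
    ultimately show ?thesis
      by (simp add: surplus_def)
  next
    case (Deterministic u)
    have u: "u \<in> candidates rs (Ns ! n)" "u \<in> L"
      using Deterministic(1) CL by (auto simp: h)
    have lev: "level rs' i = (if i = u then \<infinity> else level rs i)" for i
      using Deterministic(2) by (simp add: rs' level_snoc)
    have uN: "u \<in> Ns ! n"
      using u(1) by (rule subsetD[OF candidates_subset])
    obtain k where k: "level rs u = enat k"
      using candidates_level(1)[OF u(1) uN] by auto
    have "surplus \<gamma> L rs' - surplus \<gamma> L rs = (\<Sum>i\<in>{u}. ?f rs' i - ?f rs i)"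
      unfolding surplus_def using fin(1) u(2)
      by (intro sum_diff_eq_sum_changed) (auto simp: lev)
    then have diff: "surplus \<gamma> L rs' - surplus \<gamma> L rs
      = failure_bound \<gamma> (enat k) - 2 * half_deficit \<gamma> (enat k)"
      by (simp add: lev k)
    have gain: "2 * half_deficit \<gamma> (enat (Suc k)) \<le> surplus \<gamma> L rs' - surplus \<gamma> L rs"
      using half_deficit_le_failure_bound[OF \<gamma>, of k] unfolding diff by linarith
    have "half_deficit \<gamma> (level rs' i) \<le> half_deficit \<gamma> (enat (Suc k))" if i: "i \<in> Ns ! n" for i
    proof (rule half_deficit_antimono[OF \<gamma>])
      \<comment> \<open>A neighbor tied with \<open>u\<close> would be a second candidate, so all
        others have level at least \<open>k + 1\<close>, where the gain suffices.\<close>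
      have "enat k < level rs i" if "i \<noteq> u"
      proof -
        have "i \<notin> candidates rs (Ns ! n)"
          using Deterministic(1) that by (simp add: h)
        then have "level rs i \<noteq> enat k"
          using candidates_level(3)[OF u(1) i] k by metis
        then show ?thesis
          using candidates_level(2)[OF u(1) i] k by (simp add: order.strict_iff_order)
      qed
      then show "enat (Suc k) \<le> level rs' i"
        by (auto simp: lev Suc_ile_eq)
    qed
    then show ?thesis
      using gain half_deficit_nonneg[OF \<gamma>, of "enat (Suc k)"] by fastforce
  next
    case (Randomized P)
    then obtain u v where P: "P = {u, v}" "u \<noteq> v"
      by (auto simp: card_2_iff)
    have uv: "u \<in> candidates rs (Ns ! n)" "v \<in> candidates rs (Ns ! n)" "P \<subseteq> L"
      using Randomized(1) CL P by (auto simp: h)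
    have uvN: "u \<in> Ns ! n" "v \<in> Ns ! n"
      using uv(1,2) by (auto dest: subsetD[OF candidates_subset])
    obtain k where k: "level rs u = enat k"
      using candidates_level(1)[OF uv(1) uvN(1)] by auto
    have kv: "level rs v = enat k"
      using candidates_level(2)[OF uv(1) uvN(2)] candidates_level(2)[OF uv(2) uvN(1)] k by simp
    have lev: "level rs' i = (if i \<in> P then eSuc (level rs i) else level rs i)" for i
      using Randomized(3) by (auto simp: rs' level_snoc)
    have "surplus \<gamma> L rs' - surplus \<gamma> L rs = (\<Sum>i\<in>P. ?f rs' i - ?f rs i)"
      unfolding surplus_def using fin(1) uv(3)
      by (intro sum_diff_eq_sum_changed) (auto simp: lev)
    \<comment> \<open>Each of the two candidates contributes \<open>half_deficit\<close> at their
      common level \<open>k\<close>.\<close>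
    then have gain: "surplus \<gamma> L rs' - surplus \<gamma> L rs = 2 * half_deficit \<gamma> (enat k)"
      using failure_bound_diff[OF \<gamma>, of k] P by (simp add: lev k kv eSuc_enat)
    have "half_deficit \<gamma> (level rs' i) \<le> half_deficit \<gamma> (enat k)" if i: "i \<in> Ns ! n" for i
    proof (rule half_deficit_antimono[OF \<gamma>])
      show "enat k \<le> level rs' i"
        using candidates_level(2)[OF uv(1) i] k
        by (auto simp: lev intro: order_trans[OF _ ile_eSuc])
    qed
    then show ?thesis
      using gain half_deficit_nonneg[OF \<gamma>, of "enat k"] by auto
  qed
  then show "surplus \<gamma> L rs \<le> surplus \<gamma> L rs'"
    and "\<And>i. i \<in> Ns ! n \<Longrightarrow> 2 * half_deficit \<gamma> (level rs' i) \<le> surplus \<gamma> L rs' - surplus \<gamma> L rs"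
    by auto
qed

lemma level_append_mono: "level rs i \<le> level (rs @ rs') i"
proof (induction rs' rule: rev_induct)
  case (snoc r rs')
  have "level (rs @ rs') i \<le> level ((rs @ rs') @ [r]) i"
    unfolding level_snoc[of "rs @ rs'"] by (simp add: ile_eSuc)
  then show ?case
    using snoc by simp
qed simp

lemma level_rounds_mono:
  assumes "m \<le> n"
  shows "level (rounds pick L Ns m) i \<le> level (rounds pick L Ns n) i"
  by (metis assms append_take_drop_id level_append_mono take_rounds)

text \<open>Weak duality: the covering inequalities are added over the edges of \<open>E\<close>. A
  matching meets each vertex at most once and the duals are nonnegative, so the total is at most the
  sum of all duals.\<close>

lemma greedy_ratio_times_matching_le:
  assumes \<gamma>: "\<gamma> \<in> {0..1}" and "choice_rule pick" and inst: "matching_instance L Ns"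
    and E: "is_matching Ns E"
  shows "greedy_ratio \<gamma> * real (card E)
    \<le> (\<Sum>i\<in>L. 1 - failure_bound \<gamma> (level (rounds pick L Ns (length Ns)) i))"
proof -
  let ?n = "length Ns"
  let ?\<Phi> = "\<lambda>t. surplus \<gamma> L (rounds pick L Ns t)"
  let ?\<alpha> = "\<lambda>i. greedy_ratio \<gamma> - 2 * half_deficit \<gamma> (level (rounds pick L Ns ?n) i)"
  have finL: "finite L"
    using inst by (simp add: matching_instance_def)
  have E_sub: "E \<subseteq> edges Ns" and inj: "inj_on fst E" "inj_on snd E"
    using E by (auto simp: is_matching_def)
  have fst_E: "fst ` E \<subseteq> L" and snd_E: "snd ` E \<subseteq> {..<?n}"
    using E_sub matching_instance_nth(1)[OF inst] by (force simp: edges_def)+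
  have cover: "greedy_ratio \<gamma> \<le> ?\<alpha> (fst e) + (?\<Phi> (Suc (snd e)) - ?\<Phi> (snd e))" if "e \<in> E" for e
  proof -
    have e: "snd e < ?n" "fst e \<in> Ns ! snd e"
      using that E_sub by (auto simp: edges_def)
    \<comment> \<open>The edge is covered right after its online endpoint arrives; later rounds only
      raise the level, hence only raise the offline dual.\<close>
    have "half_deficit \<gamma> (level (rounds pick L Ns ?n) (fst e))
      \<le> half_deficit \<gamma> (level (rounds pick L Ns (Suc (snd e))) (fst e))"
      using e(1) by (intro half_deficit_antimono[OF \<gamma>] level_rounds_mono) simp
    then show ?thesis
      using surplus_Suc(2)[OF assms(1-3) e] by linarith
  qed
  \<comment> \<open>The deficit is largest at level 0, where it equals half the ratio.\<close>
  have \<alpha>_nonneg: "0 \<le> ?\<alpha> i" for i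
    using half_deficit_antimono[OF \<gamma> zero_le, of "level (rounds pick L Ns ?n) i"] by simp
  have "greedy_ratio \<gamma> * real (card E) = (\<Sum>e\<in>E. greedy_ratio \<gamma>)"
    by simp
  also have "\<dots> \<le> (\<Sum>e\<in>E. ?\<alpha> (fst e) + (?\<Phi> (Suc (snd e)) - ?\<Phi> (snd e)))"
    by (intro sum_mono cover)
  also have "\<dots> = (\<Sum>i\<in>fst ` E. ?\<alpha> i) + (\<Sum>t\<in>snd ` E. ?\<Phi> (Suc t) - ?\<Phi> t)"
    using inj by (simp only: sum.distrib sum.reindex o_def)
  also have "\<dots> \<le> (\<Sum>i\<in>L. ?\<alpha> i) + (\<Sum>t<?n. ?\<Phi> (Suc t) - ?\<Phi> t)"
    using finL fst_E snd_E \<alpha>_nonneg surplus_Suc(1)[OF assms(1-3)]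
    by (intro add_mono sum_mono2) auto
  also have "(\<Sum>t<?n. ?\<Phi> (Suc t) - ?\<Phi> t) = ?\<Phi> ?n"
    by (subst sum_lessThan_telescope) (simp add: surplus_def)
  \<comment> \<open>The offline duals cancel against those subtracted in the final surplus.\<close>
  also have "(\<Sum>i\<in>L. ?\<alpha> i) + ?\<Phi> ?n
      = (\<Sum>i\<in>L. 1 - failure_bound \<gamma> (level (rounds pick L Ns ?n) i))"
    by (simp add: surplus_def sum.distrib[symmetric])
  finally show ?thesis .
qed

lemma max_matching_attained:
  assumes "matching_instance L Ns"
  obtains E where "is_matching Ns E" "card E = max_matching_size Ns"
proof -
  have "edges Ns \<subseteq> L \<times> {..<length Ns}"
    using matching_instance_nth(1)[OF assms] by (auto simp: edges_def)
  then have "finite (edges Ns)"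
    by (rule finite_subset) (use assms in \<open>simp add: matching_instance_def\<close>)
  then have "finite {E. is_matching Ns E}"
    by (rule finite_subset[rotated, OF finite_Pow_iff[THEN iffD2]]) (auto simp: is_matching_def)
  moreover have "is_matching Ns {}"
    by (simp add: is_matching_def)
  ultimately have "Max (card ` {E. is_matching Ns E}) \<in> card ` {E. is_matching Ns E}"
    by (intro Max_in) auto
  then show thesis
    using that by (auto simp: max_matching_size_def)
qed

section \<open>The selected vertices\<close>

lemma ocs_pairs_snoc:
  "ocs_pairs (rs @ [r]) = ocs_pairs rs @ (case r of Randomized P \<Rightarrow> [P] | _ \<Rightarrow> [])"
  by (cases r) (simp_all add: ocs_pairs_def)

lemma set_ocs_pairs: "set (ocs_pairs rs) = {P. Randomized P \<in> set rs}"
  by (induction rs rule: rev_induct) (auto simp: ocs_pairs_snoc ocs_pairs_def split: round.splits)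

lemma length_filter_ocs_pairs:
  "length (filter Q (ocs_pairs rs)) = length (filter (\<lambda>r. \<exists>P. r = Randomized P \<and> Q P) rs)"
  by (induction rs rule: rev_induct) (auto simp: ocs_pairs_snoc ocs_pairs_def split: round.splits)

text \<open>Translates an OCS position into the round that produced it. The prefix equation ensures
  that the OCS call made in that round is the one at position \<open>t\<close>.\<close>

lemma ocs_pairs_position:
  assumes "t < length (ocs_pairs rs)"
  obtains r where "r < length rs" "rs ! r = Randomized (ocs_pairs rs ! t)"
    "ocs_pairs (take (Suc r) rs) = take (Suc t) (ocs_pairs rs)"
proof -
  have "\<exists>r<length rs. rs ! r = Randomized (ocs_pairs rs ! t) \<and>
      ocs_pairs (take (Suc r) rs) = take (Suc t) (ocs_pairs rs)"
    using assms
  proof (induction rs rule: rev_induct)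
    case Nil
    then show ?case by (simp add: ocs_pairs_def)
  next
    case (snoc x rs)
    show ?case
    proof (cases "t < length (ocs_pairs rs)")
      case True
      then obtain r where "r < length rs" "rs ! r = Randomized (ocs_pairs rs ! t)"
          "ocs_pairs (take (Suc r) rs) = take (Suc t) (ocs_pairs rs)"
        using snoc.IH by auto
      then show ?thesis
        using True by (intro exI[of _ r]) (auto simp: ocs_pairs_snoc nth_append)
    next
      case False
      then obtain P where "x = Randomized P" "t = length (ocs_pairs rs)"
        using snoc.prems by (cases x) (auto simp: ocs_pairs_snoc)
      then show ?thesis
        by (intro exI[of _ "length rs"]) (auto simp: ocs_pairs_snoc nth_append)
    qed
  qed
  then show thesis
    using that by blast
qed

lemma pair_sequence_rounds:
  assumes "choice_rule pick" "matching_instance L Ns" "n \<le> length Ns"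
  shows "pair_sequence L (ocs_pairs (rounds pick L Ns n))"
  unfolding pair_sequence_def set_ocs_pairs
proof safe
  fix P
  assume "Randomized P \<in> set (rounds pick L Ns n)"
  then obtain t where t: "t < n" "rounds pick L Ns n ! t = Randomized P"
    by (metis in_set_conv_nth length_rounds)
  note * = rounds_nth_Randomized[OF assms t]
  show "card P = 2" by (rule *)
  fix i
  assume "i \<in> P"
  then show "i \<in> L"
    using * matching_instance_nth(1)[OF assms(2), of t] t(1) assms(3) by auto
qed

text \<open>The algorithm recomputes its rounds on every prefix; since earlier rounds never change,
  all these calls can be read off a single list of rounds.\<close>

lemma two_choice_greedy_take:
  assumes "j < n" "n \<le> length Ns"
  shows "two_choice_greedy pick sel L (take (Suc j) Ns) =
    (case rounds pick L Ns n ! j of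
       Unmatched \<Rightarrow> None
     | Deterministic i \<Rightarrow> Some i
     | Randomized P \<Rightarrow> Some (sel (ocs_pairs (rounds pick L Ns (Suc j)))))"
proof -
  have "last (rounds pick L Ns (Suc j)) = rounds pick L Ns n ! j"
    using assms by (simp add: Let_def rounds_nth)
  moreover have "length (take (Suc j) Ns) = Suc j"
    using assms by simp
  ultimately show ?thesis
    by (simp only: two_choice_greedy_def rounds_take[OF order_refl] Let_def)
qed

lemma consecutive_all:
  assumes "t < length ps" "i \<in> ps ! t"
  shows "consecutive ps i {t. t < length ps \<and> i \<in> ps ! t}" (is "consecutive _ _ ?T")
proof -
  \<comment> \<open>This bounds the interval in \<open>consecutive\<close> by
    \<open>length ps\<close>, so every position in it is valid.\<close>
  have "Max ?T \<in> ?T"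
    using assms by (intro Max_in) auto
  then show ?thesis
    using assms unfolding consecutive_def by auto
qed

text \<open>All pairs containing \<open>i\<close> form a single consecutive block, so the OCS
  guarantee is applied to a family with one member. If there is no such pair, the lower bound is
  0.\<close>

lemma prob_select_ge:
  assumes "ocs V \<gamma> M sel" "pair_sequence V ps" "i \<in> V"
  shows "1 - failure_bound \<gamma> (enat (card {t. t < length ps \<and> i \<in> ps ! t}))
    \<le> measure M {w \<in> space M. \<exists>t<length ps. i \<in> ps ! t \<and> sel w (take (Suc t) ps) = i}"
proof (cases "\<exists>t<length ps. i \<in> ps ! t")
  case True
  let ?T = "{t. t < length ps \<and> i \<in> ps ! t}"
  have "\<forall>T\<in>{?T}. consecutive ps i T"
    using True consecutive_all by fastforce
  moreover have "disjoint {?T}"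
    by simp
  ultimately have "1 - (\<Prod>T\<in>{?T}. (1 / 2) ^ card T * (1 - \<gamma>) ^ (card T - 1))
      \<le> measure M {w \<in> space M. \<exists>t\<in>\<Union>{?T}. sel w (take (Suc t) ps) = i}"
    using assms unfolding ocs_def by blast
  then show ?thesis
    by (simp add: failure_bound_def conj_assoc)
next
  case False
  then have none: "{t. t < length ps \<and> i \<in> ps ! t} = {}"
    by auto
  show ?thesis
    unfolding none by (simp add: failure_bound_def)
qed

lemma randomized_matching_algorithm_two_choice_greedy:
  assumes ocs: "\<And>L. finite L \<Longrightarrow> ocs L \<gamma> (M L) (select L)"
    and pick: "choice_rule pick"
  shows "randomized_matching_algorithm M (\<lambda>L w. two_choice_greedy pick (select L w) L)"
  unfolding randomized_matching_algorithm_def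
proof (intro conjI allI impI)
  fix L :: "'a set"
  assume "finite L"
  then show "prob_space (M L)"
    using ocs by (auto simp: ocs_def randomized_selection_algorithm_def)
next
  fix L :: "'a set" and h
  assume *: "matching_instance L h \<and> h \<noteq> []"
  define j where "j = length h - 1"
  define rs where "rs = rounds pick L h (length h)"
  have h: "matching_instance L h" "h \<noteq> []" "finite L"
    using * by (auto simp: matching_instance_def)
  have j: "j < length h" "Suc j = length h"
    using h(2) by (auto simp: j_def)
  have last_h: "last h = h ! j"
    using h(2) by (simp add: j_def last_conv_nth)
  have alg: "two_choice_greedy pick sel L h =
      (case rs ! j of Unmatched \<Rightarrow> None | Deterministic i \<Rightarrow> Some i
       | Randomized P \<Rightarrow> Some (sel (ocs_pairs rs)))" for sel
    using two_choice_greedy_take[OF j(1) order_refl, of pick sel L] unfolding j(2) rs_def by simp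
  have sel: "(\<lambda>w. select L w (ocs_pairs rs)) \<in> measurable (M L) (count_space UNIV)"
      "\<forall>w\<in>space (M L). select L w (ocs_pairs rs) \<in> P"
    if P: "rs ! j = Randomized P" for P
  proof -
    \<comment> \<open>The current pair is the last one passed to the OCS, so the selected element
      lies in it.\<close>
    have "rs = take j rs @ [Randomized P]"
      using j P take_Suc_conv_app_nth[of j rs] by (simp add: rs_def)
    then have "ocs_pairs rs = ocs_pairs (take j rs @ [Randomized P])"
      by (rule arg_cong)
    then have "ocs_pairs rs \<noteq> []" "last (ocs_pairs rs) = P"
      by (simp_all add: ocs_pairs_snoc)
    moreover have "pair_sequence L (ocs_pairs rs)"
      unfolding rs_def by (rule pair_sequence_rounds[OF pick h(1) order_refl])
    ultimately show "(\<lambda>w. select L w (ocs_pairs rs)) \<in> measurable (M L) (count_space UNIV)"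
        "\<forall>w\<in>space (M L). select L w (ocs_pairs rs) \<in> P"
      using ocs[OF h(3)] unfolding ocs_def randomized_selection_algorithm_def
      by blast+
  qed
  show "(\<lambda>w. two_choice_greedy pick (select L w) L h) \<in> measurable (M L) (count_space UNIV)"
  proof (cases "rs ! j")
    case (Randomized P)
    then show ?thesis
      using measurable_compose[OF sel(1)[OF Randomized], of Some "count_space UNIV"]
      by (simp add: alg)
  qed (simp_all add: alg)
  show "\<forall>w\<in>space (M L). \<forall>i. two_choice_greedy pick (select L w) L h = Some i \<longrightarrow> i \<in> last h"
  proof (cases "rs ! j")
    case Unmatched
    then show ?thesis by (simp add: alg)
  next
    case (Deterministic i)
    then show ?thesis
      using rounds_nth_Deterministic[OF pick h(1) order_refl j(1)] by (simp add: alg last_h rs_def)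
  next
    case (Randomized P)
    then have "P \<subseteq> last h"
      using rounds_nth_Randomized(1)[OF pick h(1) order_refl j(1)] by (simp add: last_h rs_def)
    then show ?thesis
      using sel(2)[OF Randomized] Randomized by (auto simp: alg)
  qed
qed

text \<open>A deterministic round matches \<open>i\<close> with certainty. Otherwise the level of
  \<open>i\<close> is the number of OCS pairs containing it, and being selected in one of them means
  being matched.\<close>

lemma prob_matched_ge:
  assumes ocs: "ocs L \<gamma> (M L) (select L)"
    and pick: "choice_rule pick" and inst: "matching_instance L Ns" and i: "i \<in> L"
    and meas: "{w \<in> space (M L). i \<in> matched (two_choice_greedy pick (select L w) L) Ns} \<in> sets (M L)"
  shows "1 - failure_bound \<gamma> (level (rounds pick L Ns (length Ns)) i)
    \<le> measure (M L) {w \<in> space (M L). i \<in> matched (two_choice_greedy pick (select L w) L) Ns}"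
proof -
  define rs where "rs = rounds pick L Ns (length Ns)"
  interpret prob_space "M L"
    using ocs by (simp add: ocs_def randomized_selection_algorithm_def)
  have len: "length rs = length Ns"
    by (simp add: rs_def)
  have take_rs: "rounds pick L Ns (Suc r) = take (Suc r) rs" if "r < length Ns" for r
    unfolding rs_def using that by (intro take_rounds[symmetric]) simp
  have alg: "two_choice_greedy pick sel L (take (Suc r) Ns) =
      (case rs ! r of Unmatched \<Rightarrow> None | Deterministic i \<Rightarrow> Some i
       | Randomized P \<Rightarrow> Some (sel (ocs_pairs (take (Suc r) rs))))" if "r < length Ns" for r sel
    using two_choice_greedy_take[OF that order_refl, of pick sel L]
    unfolding take_rs[OF that] rs_def .
  show ?thesis
  proof (cases "Deterministic i \<in> set rs")
    case True
    then obtain r where "r < length Ns" "rs ! r = Deterministic i"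
      by (metis in_set_conv_nth len)
    then have "i \<in> matched (two_choice_greedy pick (select L w) L) Ns" for w
      using alg[of r] by (auto simp: matched_def)
    then show ?thesis
      using True by (simp add: rs_def[symmetric] level_def prob_space)
  next
    case False
    let ?ps = "ocs_pairs rs"
    have level: "level rs i = enat (card {t. t < length ?ps \<and> i \<in> ?ps ! t})"
      using False
      by (simp add: level_eq_length_filter length_filter_ocs_pairs[symmetric] length_filter_conv_card)
    have "pair_sequence L ?ps"
      unfolding rs_def by (rule pair_sequence_rounds[OF pick inst order_refl])
    then have "1 - failure_bound \<gamma> (level rs i) \<le> measure (M L) {w \<in> space (M L).
        \<exists>t<length ?ps. i \<in> ?ps ! t \<and> select L w (take (Suc t) ?ps) = i}"
      unfolding level by (rule prob_select_ge[OF ocs _ i])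
    also have "\<dots> \<le> measure (M L)
        {w \<in> space (M L). i \<in> matched (two_choice_greedy pick (select L w) L) Ns}"
    proof (intro finite_measure_mono meas subsetI CollectI conjI)
      fix w
      assume "w \<in> {w \<in> space (M L).
        \<exists>t<length ?ps. i \<in> ?ps ! t \<and> select L w (take (Suc t) ?ps) = i}"
      then obtain t where t: "w \<in> space (M L)" "t < length ?ps" "select L w (take (Suc t) ?ps) = i"
        by auto
      then show "w \<in> space (M L)"
        by simp
      obtain r where "r < length rs" "rs ! r = Randomized (?ps ! t)"
          "ocs_pairs (take (Suc r) rs) = take (Suc t) ?ps"
        using t(2) by (rule ocs_pairs_position)
      then show "i \<in> matched (two_choice_greedy pick (select L w) L) Ns"
        using t(3) alg[of r] len by (auto simp: matched_def)
    qed
    finally show ?thesis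
      by (simp add: rs_def)
  qed
qed

section \<open>Expected objective and competitive ratio\<close>

lemma matched_sets:
  assumes "randomized_matching_algorithm M A" "matching_instance L Ns"
  shows "{w \<in> space (M L). i \<in> matched (A L w) Ns} \<in> sets (M L)"
proof -
  have "{w \<in> space (M L). A L w (take (Suc j) Ns) = Some i} \<in> sets (M L)" if "j < length Ns" for j
  proof -
    have "matching_instance L (take (Suc j) Ns)" "take (Suc j) Ns \<noteq> []"
      using assms(2) that by (auto simp: matching_instance_def dest: in_set_takeD)
    then have "(\<lambda>w. A L w (take (Suc j) Ns)) \<in> measurable (M L) (count_space UNIV)"
      using assms(1) unfolding randomized_matching_algorithm_def by blast
    then have "(\<lambda>w. A L w (take (Suc j) Ns)) -` {Some i} \<inter> space (M L) \<in> sets (M L)"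
      by (rule measurable_sets) simp
    then show ?thesis
      by (simp add: vimage_def Int_def conj_commute)
  qed
  then have "(\<Union>j<length Ns. {w \<in> space (M L). A L w (take (Suc j) Ns) = Some i}) \<in> sets (M L)"
    by (intro sets.finite_UN) auto
  also have "(\<Union>j<length Ns. {w \<in> space (M L). A L w (take (Suc j) Ns) = Some i})
      = {w \<in> space (M L). i \<in> matched (A L w) Ns}"
    by (auto simp: matched_def)
  finally show ?thesis .
qed

lemma expected_objective_eq:
  assumes "randomized_matching_algorithm M A" "matching_instance L Ns"
  shows "prob_space.expectation (M L) (\<lambda>w. real (card (matched (A L w) Ns)))
    = (\<Sum>i\<in>L. measure (M L) {w \<in> space (M L). i \<in> matched (A L w) Ns})"
proof -
  have fin: "finite L"
    using assms(2) by (simp add: matching_instance_def)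
  then interpret prob_space "M L"
    using assms(1) by (simp add: randomized_matching_algorithm_def)
  let ?S = "\<lambda>i. {w \<in> space (M L). i \<in> matched (A L w) Ns}"
  have S: "?S i \<in> sets (M L)" for i
    by (rule matched_sets[OF assms])
  have "real (card (matched (A L w) Ns)) = (\<Sum>i\<in>L. indicator (?S i) w)" if w: "w \<in> space (M L)" for w
  proof -
    \<comment> \<open>Decisions are neighbors of the current vertex, so counting over
      \<open>L\<close> misses no matched vertex; linearity of expectation then applies.\<close>
    have "matched (A L w) Ns \<subseteq> L"
    proof
      fix i
      assume "i \<in> matched (A L w) Ns"
      then obtain j where j: "j < length Ns" "A L w (take (Suc j) Ns) = Some i"
        by (auto simp: matched_def)
      have "matching_instance L (take (Suc j) Ns)" "take (Suc j) Ns \<noteq> []"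
        using assms(2) j(1) by (auto simp: matching_instance_def dest: in_set_takeD)
      then have "i \<in> last (take (Suc j) Ns)"
        using assms(1) w j(2) unfolding randomized_matching_algorithm_def by blast
      then show "i \<in> L"
        using last_take_Suc[OF j(1)] matching_instance_nth(1)[OF assms(2) j(1)] by auto
    qed
    then have "real (card (matched (A L w) Ns)) = (\<Sum>i\<in>L. indicator (matched (A L w) Ns) i)"
      using fin by (simp add: indicator_def sum.If_cases Int_absorb1)
    then show ?thesis
      using w by (simp add: indicator_def)
  qed
  then have "expectation (\<lambda>w. real (card (matched (A L w) Ns)))
      = expectation (\<lambda>w. \<Sum>i\<in>L. indicator (?S i) w)"
    by (intro Bochner_Integration.integral_cong) auto
  also have "\<dots> = (\<Sum>i\<in>L. expectation (indicator (?S i)))"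
    using S by (intro Bochner_Integration.integral_sum) (simp add: emeasure_eq_measure)
  finally show ?thesis
    using S by simp
qed

theorem competitive_two_choice_greedy:
  assumes ocs: "\<And>L. finite L \<Longrightarrow> ocs L \<gamma> (M L) (select L)"
    and pick: "choice_rule pick"
  shows "competitive (greedy_ratio \<gamma>) M (\<lambda>L w. two_choice_greedy pick (select L w) L)"
proof -
  \<comment> \<open>The range of \<open>\<gamma>\<close> is part of being an OCS; the empty ground
    set is a convenient instance.\<close>
  have \<gamma>: "\<gamma> \<in> {0..1}"
    using ocs[of "{}"] by (simp add: ocs_def)
  have alg: "randomized_matching_algorithm M (\<lambda>L w. two_choice_greedy pick (select L w) L)"
    using ocs pick by (rule randomized_matching_algorithm_two_choice_greedy)
  moreover have "greedy_ratio \<gamma> * real (max_matching_size Ns) \<le> prob_space.expectation (M L)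
      (\<lambda>w. real (card (matched (two_choice_greedy pick (select L w) L) Ns)))"
    if inst: "matching_instance L Ns" for L Ns
  proof -
    obtain E where E: "is_matching Ns E" "card E = max_matching_size Ns"
      using inst by (rule max_matching_attained)
    have "finite L"
      using inst by (simp add: matching_instance_def)
    then have "(\<Sum>i\<in>L. 1 - failure_bound \<gamma> (level (rounds pick L Ns (length Ns)) i))
        \<le> (\<Sum>i\<in>L. measure (M L)
            {w \<in> space (M L). i \<in> matched (two_choice_greedy pick (select L w) L) Ns})"
      using ocs by (intro sum_mono prob_matched_ge pick inst matched_sets[OF alg inst]) auto
    then show ?thesis
      using greedy_ratio_times_matching_le[OF \<gamma> pick inst E(1)]
        expected_objective_eq[OF alg inst] E(2) by simp
  qed
  ultimately show ?thesis
    by (simp add: competitive_def)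
qed

lemma competitive_mono:
  assumes "competitive \<Gamma> M A" "\<Gamma>' \<le> \<Gamma>"
  shows "competitive \<Gamma>' M A"
  using assms unfolding competitive_def
  by (meson mult_right_mono of_nat_0_le_iff order_trans)

theorem theorem14:
  fixes M :: "'a set \<Rightarrow> 'w measure"
    and select :: "'a set \<Rightarrow> 'w \<Rightarrow> 'a set list \<Rightarrow> 'a"
    and pick :: "'a set \<Rightarrow> 'a set list \<Rightarrow> 'a set \<Rightarrow> 'a set"
  assumes "\<And>L. finite L \<Longrightarrow> ocs L (0.1099 :: real) (M L) (select L)"
    and "choice_rule pick"
  shows "competitive (0.508 :: real) M (\<lambda>L w. two_choice_greedy pick (select L w) L)"
proof (rule competitive_mono)
  show "competitive (greedy_ratio 0.1099) M (\<lambda>L w. two_choice_greedy pick (select L w) L)"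
    using assms by (rule competitive_two_choice_greedy)
  \<comment> \<open>The ratio is \<open>3.2198 / 6.3297\<close>, about 0.5087.\<close>
  show "0.508 \<le> greedy_ratio 0.1099"
    by (simp add: greedy_ratio_def)
qed

end
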